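(* Let $n\in\mathbb{N}$. (i) Let $p,q_0,q_1\in\mathcal{P}(\mathbb{R}^n)$ with $q_0(\cdot)\le q_1(\cdot)$ pointwise. Then $L_{p(\cdot),q_0(\cdot)}(\mathbb{R}^n)\hookrightarrow L_{p(\cdot),q_1(\cdot)}(\mathbb{R}^n)$. (ii) Let $q\in\mathcal{P}(\mathbb{R}^n)$. Then $L_{\infty,q(\cdot)}(\mathbb{R}^n)=L_\infty(\mathbb{R}^n)$, where $L_{\infty,q(\cdot)}(\mathbb{R}^n)$ is the space $L_{p(\cdot),q(\cdot)}(\mathbb{R}^n)$ with $p(\cdot)\equiv\infty$. (iii) Let $p_0,p_1,q_0,q_1\in\mathcal{P}(\mathbb{R}^n)$ with $p_0^+<\infty$ and $\alpha:=(p_1/p_0)^->1$. Then there is a constant $c>0$ such that $$\|f|L_{p_0(\cdot),q_0(\cdot)}(\mathbb{R}^n)\|\le c\,\|f|L_{p_1(\cdot),q_1(\cdot)}(\mathbb{R}^n)\|$$ for all measurable $f$ with $\operatorname{supp} f\subset[0,1]^n$, with $c$ independent of $f$. (iv) Let $p_0,p_1,q\in\mathcal{P}(\mathbb{R}^n)$ with $p_0(\cdot)\le p_1(\cdot)$ pointwise. Then there is a constant $c>0$ such that $$\|f|L_{p_0(\cdot),q(\cdot)}(\mathbb{R}^n)\|\le c\,\|f|L_{p_1(\cdot),q(\cdot)}(\mathbb{R}^n)\|$$ for all measurable $f$ with $\operatorname{supp} f\subset[0,1]^n$, with $c$ independent of $f$.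
   Context: Functions are identified when they agree almost everywhere. $X\hookrightarrow Y$ means $X\subset Y$ and $\|f|Y\|\le c\|f|X\|$ for all $f\in X$ with a constant $c$ independent of $f$. Equality of two quasi-normed function spaces means that they consist of the same functions and that their quasi-norms are equivalent. For a measurable function $r:\mathbb{R}^n\to(0,\infty]$ write $r^-=\operatorname{ess\,inf}_{x\in\mathbb{R}^n}r(x)$ and $r^+=\operatorname{ess\,sup}_{x\in\mathbb{R}^n}r(x)$. $\mathcal{P}(\mathbb{R}^n)$ is the class of all measurable functions $p:\mathbb{R}^n\to(0,\infty]$ with $p^->0$; the value $\infty$ is allowed. For $t\ge 0$ put $\varphi_p(t)=t^p$ if $p\in(0,\infty)$; $\varphi_\infty(t)=0$ if $t\le1$ and $\varphi_\infty(t)=\infty$ if $t>1$. For $p\in\mathcal{P}(\mathbb{R}^n)$ and measurable $f$ let $\varrho_{p(\cdot)}(f)=\int_{\mathbb{R}^n}\varphi_{p(x)}(|f(x)|)\,dx$. For a sequence $(f_k)_{k\in\mathbb{Z}}$ of measurable functions and $p,q\in\mathcal{P}(\mathbb{R}^n)$ let $$\varrho_{\ell_{q(\cdot)}(L_{p(\cdot)})}\big((f_k)_k\big)=\sum_{k\in\mathbb{Z}}\inf\Big\{\lambda_k>0:\varrho_{p(\cdot)}\Big(\frac{f_k}{\lambda_k^{1/q(\cdot)}}\Big)\le1\Big\},$$ with the conventions $\lambda^{1/\infty}=1$ and $\inf\emptyset=\infty$. For measurable $f:\mathbb{R}^n\to\mathbb{C}$ put $$\|f|L_{p(\cdot),q(\cdot)}(\mathbb{R}^n)\|=\inf\Big\{\lambda>0:\varrho_{\ell_{q(\cdot)}(L_{p(\cdot)})}\Big(\big(2^k\chi_{\{x\in\mathbb{R}^n:|f(x)/\lambda|>2^k\}}\big)_{k\in\mathbb{Z}}\Big)\le1\Big\}\in[0,\infty],$$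 where $\chi_A$ is the characteristic function of $A$; $L_{p(\cdot),q(\cdot)}(\mathbb{R}^n)$ is the collection of all measurable $f:\mathbb{R}^n\to\mathbb{C}$ for which this is finite. *)

theory Defs
  imports "HOL-Analysis.Analysis" "HOL-Probability.Essential_Supremum"
begin

definition essinf :: "'a measure \<Rightarrow> ('a \<Rightarrow> ennreal) \<Rightarrow> ennreal" where
  "essinf M r = Sup {c. AE x in M. c \<le> r x}"

definition variable_exponents :: "('a::euclidean_space \<Rightarrow> ennreal) set" where
  "variable_exponents =
     {p \<in> borel_measurable lebesgue. (\<forall>x. 0 < p x) \<and> 0 < essinf lebesgue p}"

definition exponent_phi :: "ennreal \<Rightarrow> real \<Rightarrow> ennreal" where
  "exponent_phi p t =
     (if p = \<infinity> then (if t \<le> 1 then 0 else \<infinity>) else ennreal (t powr enn2real p))"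

definition modular :: "('a::euclidean_space \<Rightarrow> ennreal) \<Rightarrow> ('a \<Rightarrow> complex) \<Rightarrow> ennreal" where
  "modular p f = (\<integral>\<^sup>+ x. exponent_phi (p x) (cmod (f x)) \<partial>lebesgue)"

text \<open>The exponent below is \<open>1/q(x)\<close>; for \<open>q(x) = \<infinity>\<close> it is \<open>0\<close>, so the factor
  \<open>l powr (1/q(x))\<close> is \<open>1\<close> since \<open>l > 0\<close>. In \<^typ>\<open>ennreal\<close> the infimum over the
  empty set is \<open>\<infinity>\<close>.\<close>

definition mixed_modular ::
  "('a::euclidean_space \<Rightarrow> ennreal) \<Rightarrow> ('a \<Rightarrow> ennreal) \<Rightarrow> (int \<Rightarrow> 'a \<Rightarrow> complex) \<Rightarrow> ennreal" where
  "mixed_modular q p F =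
     (\<Sum>\<^sub>\<infinity>k. INF l \<in> {l::real. 0 < l \<and>
        modular p (\<lambda>x. F k x / of_real (l powr enn2real (inverse (q x)))) \<le> 1}. ennreal l)"

definition lorentz_norm ::
  "('a::euclidean_space \<Rightarrow> ennreal) \<Rightarrow> ('a \<Rightarrow> ennreal) \<Rightarrow> ('a \<Rightarrow> complex) \<Rightarrow> ennreal" where
  "lorentz_norm p q f =
     (INF l \<in> {l::real. 0 < l \<and>
        mixed_modular q p
          (\<lambda>k x. of_real (2 powi k) * indicator {y. cmod (f y / of_real l) > 2 powi k} x) \<le> 1}.
      ennreal l)"

text \<open>Function spaces are represented by sets of functions closed under almost everywhere
  equality instead of sets of equivalence classes; see \<open>lorentz_norm_cong_AE\<close>.\<close>

definition lorentz_space ::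
  "('a::euclidean_space \<Rightarrow> ennreal) \<Rightarrow> ('a \<Rightarrow> ennreal) \<Rightarrow> ('a \<Rightarrow> complex) set" where
  "lorentz_space p q = {f \<in> borel_measurable lebesgue. lorentz_norm p q f < \<infinity>}"

definition Linf_norm :: "('a::euclidean_space \<Rightarrow> complex) \<Rightarrow> ennreal" where
  "Linf_norm f = esssup lebesgue (\<lambda>x. ennreal (cmod (f x)))"

definition Linf_space :: "('a::euclidean_space \<Rightarrow> complex) set" where
  "Linf_space = {f \<in> borel_measurable lebesgue. Linf_norm f < \<infinity>}"

definition continuously_embedded ::
  "'f set \<Rightarrow> ('f \<Rightarrow> ennreal) \<Rightarrow> 'f set \<Rightarrow> ('f \<Rightarrow> ennreal) \<Rightarrow> bool" where
  "continuously_embedded X nX Y nY \<longleftrightarrow>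
     X \<subseteq> Y \<and> (\<exists>c::real. 0 < c \<and> (\<forall>f\<in>X. nY f \<le> ennreal c * nX f))"

definition equal_with_equivalent_norms ::
  "'f set \<Rightarrow> ('f \<Rightarrow> ennreal) \<Rightarrow> 'f set \<Rightarrow> ('f \<Rightarrow> ennreal) \<Rightarrow> bool" where
  "equal_with_equivalent_norms X nX Y nY \<longleftrightarrow>
     X = Y \<and> (\<exists>c C::real. 0 < c \<and> 0 < C \<and>
       (\<forall>f\<in>X. ennreal c * nX f \<le> nY f \<and> nY f \<le> ennreal C * nX f))"

text \<open>The support of a function that is determined only up to null sets: the complement of the
  largest open set on which the function vanishes almost everywhere.\<close>

definition ess_support :: "('a::euclidean_space \<Rightarrow> complex) \<Rightarrow> 'a set" where
  "ess_support f = - \<Union>{U. open U \<and> (AE x in lebesgue. x \<in> U \<longrightarrow> f x = 0)}"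

definition unit_cube :: "(real^'n) set" where
  "unit_cube = {x. \<forall>i. 0 \<le> x $ i \<and> x $ i \<le> 1}"

lemma modular_cong_AE:
  assumes "AE x in lebesgue. f x = g x"
  shows "modular p f = modular p g"
  unfolding modular_def by (rule nn_integral_cong_AE) (use assms in \<open>auto elim: eventually_mono\<close>)

lemma lorentz_norm_cong_AE:
  assumes "AE x in lebesgue. f x = g x"
  shows "lorentz_norm p q f = lorentz_norm p q g"
proof -
  have "modular p (\<lambda>x. of_real (2 powi k) * indicator {y. cmod (f y / of_real l) > 2 powi k} x
            / of_real (m powr enn2real (inverse (q x))))
      = modular p (\<lambda>x. of_real (2 powi k) * indicator {y. cmod (g y / of_real l) > 2 powi k} x
            / of_real (m powr enn2real (inverse (q x))))" for k :: int and l m :: real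
    by (rule modular_cong_AE) (use assms in \<open>auto elim!: eventually_mono simp: indicator_def\<close>)
  then show ?thesis
    unfolding lorentz_norm_def mixed_modular_def by simp
qed

end

theory Submission
  imports Defs
begin

text \<open>
  For a level \<open>l\<close> and an integer \<open>k\<close>, let \<open>A\<^sub>k\<close> be the superlevel set \<open>{|f| / l > 2^k}\<close>.
  The quasi-norm asks for the least \<open>l\<close> such that the costs
  \<open>inf {m > 0. \<integral>\<^sub>A\<^sub>k \<phi>\<^sub>p (2^k m^(-1/q)) \<le> 1}\<close> of the layers \<open>A\<^sub>k\<close> sum up to at most \<open>1\<close>
  (\<open>lorentz_norm_altdef\<close>).  Everything rests on two observations about this formula.

  \<^item> Replacing \<open>l\<close> by \<open>2^j l\<close> merely renumbers the superlevel sets, so its effect is that the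
    height \<open>2^k\<close> attached to \<open>A\<^sub>k\<close> drops to \<open>2^(k-j)\<close> (\<open>lorentz_norm_le_shift\<close>).  It therefore
    suffices to bound the costs of the original sets with heights lowered by a factor \<open>2^j\<close>
    that does not depend on \<open>f\<close>.
  \<^item> Lowering the height by \<open>2^j\<close> gains something twice: since \<open>q\<close> is bounded below by some
    \<open>c > 0\<close>, all costs shrink by \<open>2^(-j c)\<close> (\<open>layer_cost_scale\<close>), and since \<open>p\<close> is bounded below by
    some \<open>c > 0\<close>, an integral bounded by \<open>B\<close> becomes at most \<open>2^(-j c) B\<close>
    (\<open>layer_modular_shrink\<close>).  Hence constants in either place can be absorbed, no matter
    how large \<open>p\<close> and \<open>q\<close> are, and a geometric bound \<open>2^(-\<epsilon>|k|)\<close> on the costs suffices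
    (\<open>lorentz_norm_le_of_geometric_costs\<close>).

  The four assertions follow.  Enlarging \<open>q\<close> does not enlarge a cost below \<open>1\<close>, because
  \<open>m^(1/q)\<close> increases with \<open>q\<close> for \<open>m < 1\<close>; one halving of the heights makes all costs less
  than \<open>1\<close>.  For \<open>p = \<infinity>\<close> the modular is \<open>0\<close> or \<open>\<infinity>\<close>: a single layer with large \<open>k\<close> must be a null
  set, which bounds \<open>f\<close>, and conversely a bounded \<open>f\<close>, at the level \<open>l\<close> of its bound, has null
  layers for \<open>k \<ge> 0\<close> and costs at most \<open>2^(-c|k|)\<close> for \<open>k < 0\<close>.  The two inequalities for functions
  living on the cube use only that the cube has finite measure, through
  \<open>\<phi>\<^sub>p\<^sub>0(t) \<le> 1 + \<phi>\<^sub>p\<^sub>1(u)\<close> for \<open>t \<le> max 1 u^\<alpha>\<close> and \<open>\<alpha> p\<^sub>0 \<le> p\<^sub>1\<close>.  With \<open>\<alpha> = 1\<close> and \<open>t = u\<close> every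
  \<open>m\<close> that is admissible for \<open>p\<^sub>1\<close> is admissible for \<open>p\<^sub>0\<close> up to a constant.  With \<open>\<alpha> > 1\<close> each
  single layer alone, whatever \<open>q\<^sub>1\<close>, leaves the room \<open>u^(\<alpha>-1)\<close> in which the geometric
  \<open>m = 2^(-\<epsilon>|k|)\<close> fits, whatever \<open>q\<^sub>0\<close>.
\<close>

section \<open>Layers and their costs\<close>

definition superlevel :: "('a \<Rightarrow> complex) \<Rightarrow> real \<Rightarrow> int \<Rightarrow> 'a set" where
  "superlevel f l k = {y. cmod (f y / of_real l) > 2 powi k}"

text \<open>The height \<open>a\<close> is kept separate from the set: dilating the level of a function decouples the
  height \<open>2^k\<close> from the \<open>k\<close>-th superlevel set.\<close>

definition layer_modular ::
  "('a::euclidean_space \<Rightarrow> ennreal) \<Rightarrow> ('a \<Rightarrow> ennreal) \<Rightarrow> real \<Rightarrow> real \<Rightarrow> 'a set \<Rightarrow> ennreal" where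
  "layer_modular p q a m A =
     (\<integral>\<^sup>+ x. exponent_phi (p x) (a / m powr enn2real (inverse (q x))) * indicator A x \<partial>lebesgue)"

definition layer_cost ::
  "('a::euclidean_space \<Rightarrow> ennreal) \<Rightarrow> ('a \<Rightarrow> ennreal) \<Rightarrow> real \<Rightarrow> 'a set \<Rightarrow> ennreal" where
  "layer_cost p q a A = (INF m \<in> {m. 0 < m \<and> layer_modular p q a m A \<le> 1}. ennreal m)"

lemma exponent_phi_zero [simp]: "exponent_phi p 0 = 0"
  by (simp add: exponent_phi_def)

lemma modular_layer:
  assumes "0 \<le> a"
  shows "modular p (\<lambda>x. of_real a * indicator A x / of_real (m powr enn2real (inverse (q x))))
       = layer_modular p q a m A"
  unfolding modular_def layer_modular_def
  by (rule nn_integral_cong) (use assms in \<open>auto simp: indicator_def norm_divide\<close>)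

lemma lorentz_norm_altdef:
  "lorentz_norm p q f =
     (INF l \<in> {l. 0 < l \<and> (\<Sum>\<^sub>\<infinity>k. layer_cost p q (2 powi k) (superlevel f l k)) \<le> 1}. ennreal l)"
proof -
  have "modular p (\<lambda>x. of_real (2 powi k) * indicator {y. cmod (f y / of_real l) > 2 powi k} x
            / of_real (m powr enn2real (inverse (q x))))
      = layer_modular p q (2 powi k) m (superlevel f l k)" for k l m
    unfolding superlevel_def by (rule modular_layer) simp
  then show ?thesis
    unfolding lorentz_norm_def mixed_modular_def layer_cost_def by simp
qed

section \<open>Exponents and the integrand\<close>

lemma variable_exponentsD:
  assumes "p \<in> variable_exponents"
  shows "p \<in> borel_measurable lebesgue" "\<And>x. 0 < p x"
  using assms by (auto simp: variable_exponents_def)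

text \<open>The supremum in the essential infimum is approached by admissible constants; when such a
  constant is infinite, any larger real number serves instead.\<close>

lemma essinf_greater_real:
  assumes "ennreal b < essinf M r" "0 \<le> b"
  obtains c where "b < c" "AE x in M. ennreal c \<le> r x"
proof -
  obtain d where d: "AE x in M. d \<le> r x" "ennreal b < d"
    using assms by (auto simp: essinf_def less_Sup_iff)
  show ?thesis
  proof (cases d)
    case (real e)
    then show ?thesis using d assms that[of e] by (simp add: ennreal_less_iff)
  next
    case top
    then have "AE x in M. ennreal (b + 1) \<le> r x"
      using d(1) by (auto elim!: eventually_mono simp: top_unique)
    then show ?thesis using that[of "b + 1"] by simp
  qed
qed

lemma variable_exponent_lower_bound:
  assumes "p \<in> variable_exponents"
  obtains c where "0 < c" "AE x in lebesgue. ennreal c \<le> p x"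
  using essinf_greater_real[of 0 lebesgue p] assms by (auto simp: variable_exponents_def)

lemma enn2real_inverse_antimono:
  assumes "0 < a" "a \<le> b"
  shows "enn2real (inverse b) \<le> enn2real (inverse a)"
  using assms
  by (cases a; cases b) (auto simp: inverse_ennreal le_imp_inverse_le top_unique)

lemma enn2real_inverse_le:
  assumes "0 < c" "ennreal c \<le> q"
  shows "enn2real (inverse q) \<le> 1 / c"
  using enn2real_inverse_antimono[of "ennreal c" q] assms
  by (simp add: inverse_ennreal field_simps)

lemma exponent_phi_mono: "0 \<le> s \<Longrightarrow> s \<le> t \<Longrightarrow> exponent_phi p s \<le> exponent_phi p t"
  by (auto simp: exponent_phi_def intro!: ennreal_leI powr_mono2)

text \<open>A gain from lowering heights: \<open>\<theta>^p \<le> \<theta>^c\<close> for \<open>\<theta> \<le> 1\<close> and \<open>p \<ge> c\<close>, so a lower bound on \<open>p\<close>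
  is enough. For \<open>p = \<infinity>\<close> both sides take values in \<open>{0, \<infinity>}\<close> and lowering the argument
  cannot leave the region where \<open>\<phi>\<^sub>\<infinity>\<close> vanishes.\<close>

lemma exponent_phi_scale:
  assumes "0 < c" "ennreal c \<le> p" "0 < \<theta>" "\<theta> \<le> 1" "0 \<le> t"
  shows "exponent_phi p (\<theta> * t) \<le> ennreal (\<theta> powr c) * exponent_phi p t"
proof (cases p)
  case (real r)
  then have "c \<le> r" using assms by simp
  then have "\<theta> powr r \<le> \<theta> powr c" using assms by (intro powr_mono') auto
  then have "(\<theta> * t) powr r \<le> \<theta> powr c * t powr r"
    using assms by (simp add: powr_mult mult_right_mono)
  then show ?thesis using real
    by (simp add: exponent_phi_def ennreal_mult[symmetric] ennreal_leI)
next
  case top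
  have "\<theta> * t \<le> 1" if "t \<le> 1" using that assms by (meson mult_le_one)
  then show ?thesis using top assms by (auto simp: exponent_phi_def ennreal_mult_top)
qed

text \<open>Below height \<open>1\<close> the integrand is at most \<open>1\<close>; above it, \<open>t^p0 \<le> u^(\<alpha> p0) \<le> u^p1\<close>. If
  \<open>p0 = \<infinity>\<close>, then \<open>p1 = \<infinity>\<close> as well, and \<open>u > 1\<close> makes the right-hand side infinite.\<close>

lemma exponent_phi_le_add_one:
  assumes "0 \<le> t" "0 \<le> u" "t \<le> max 1 (u powr \<alpha>)" "1 \<le> \<alpha>" "ennreal \<alpha> * p0 \<le> p1"
  shows "exponent_phi p0 t \<le> 1 + exponent_phi p1 u"
proof (cases "t \<le> 1")
  case True
  then have "exponent_phi p0 t \<le> 1"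
    using assms(1) by (auto simp: exponent_phi_def powr_le1)
  then show ?thesis by (simp add: add_increasing2)
next
  case False
  then have t: "1 < t" "t \<le> u powr \<alpha>" using assms by auto
  have u: "1 < u"
  proof (rule ccontr)
    assume "\<not> 1 < u"
    then have "u powr \<alpha> \<le> 1" using assms by (intro powr_le1) auto
    then show False using t by simp
  qed
  show ?thesis
  proof (cases p1)
    case top
    then show ?thesis using u by (simp add: exponent_phi_def)
  next
    case (real r1)
    have "p0 \<noteq> \<infinity>"
      using assms(4,5) real by (auto simp: ennreal_mult_top top_unique)
    then obtain r0 where r0: "p0 = ennreal r0" "0 \<le> r0" by (cases p0) auto
    have "\<alpha> * r0 \<le> r1"
      using assms(4,5) real r0 by (simp add: ennreal_mult[symmetric])
    have "t powr r0 \<le> (u powr \<alpha>) powr r0"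
      using t r0 by (intro powr_mono2) auto
    also have "\<dots> = u powr (\<alpha> * r0)" by (simp add: powr_powr)
    also have "\<dots> \<le> u powr r1" using u \<open>\<alpha> * r0 \<le> r1\<close> by (intro powr_mono) auto
    finally have "exponent_phi p0 t \<le> exponent_phi p1 u"
      using real r0 by (simp add: exponent_phi_def ennreal_leI)
    then show ?thesis by (simp add: add_increasing)
  qed
qed

section \<open>Dilating the level\<close>

lemma superlevel_dilate:
  "0 < l \<Longrightarrow> superlevel f (2 powi j * l) k = superlevel f l (k + j)"
  by (auto simp: superlevel_def norm_divide norm_mult norm_power_int power_int_add field_simps)

lemma superlevel_measurable [measurable]:
  assumes [measurable]: "f \<in> borel_measurable lebesgue"
  shows "superlevel f l k \<in> sets lebesgue"
proof -
  have "superlevel f l k = {y \<in> space lebesgue. 2 powi k < cmod (f y / of_real l)}"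
    by (simp add: superlevel_def)
  also have "\<dots> \<in> sets lebesgue" by measurable
  finally show ?thesis .
qed

lemma layer_integrand_measurable [measurable]:
  assumes [measurable]: "p \<in> borel_measurable lebesgue" "q \<in> borel_measurable lebesgue"
    "A \<in> sets lebesgue"
  shows "(\<lambda>x. exponent_phi (p x) (a / m powr enn2real (inverse (q x))) * indicator A x)
           \<in> borel_measurable lebesgue"
  unfolding exponent_phi_def by measurable

lemma layer_cost_leI:
  assumes "0 < m" "layer_modular p q a m A \<le> 1"
  shows "layer_cost p q a A \<le> ennreal m"
  unfolding layer_cost_def by (rule INF_lower) (use assms in auto)

lemma layer_cost_lessE:
  assumes "layer_cost p q a A < b"
  obtains m where "0 < m" "ennreal m < b" "layer_modular p q a m A \<le> 1"
  using assms unfolding layer_cost_def by (auto simp: INF_less_iff)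

text \<open>Both the cost and the quasi-norm are infima of real numbers. An inequality against either
  one, with a constant, needs to be checked only at the admissible numbers.\<close>

lemma ennreal_le_cmult_INF:
  assumes "0 < (c::real)" "\<And>i. i \<in> I \<Longrightarrow> x \<le> ennreal (c * g i)" "\<And>i. i \<in> I \<Longrightarrow> 0 \<le> g i"
  shows "x \<le> ennreal c * (INF i\<in>I. ennreal (g i))"
proof -
  have "x / ennreal c \<le> (INF i\<in>I. ennreal (g i))"
  proof (rule INF_greatest)
    fix i assume "i \<in> I"
    then have "x \<le> ennreal (g i) * ennreal c"
      using assms by (metis ennreal_mult' less_imp_le mult.commute)
    then show "x / ennreal c \<le> ennreal (g i)"
      using assms(1) by (intro divide_le_posI_ennreal) (auto simp: mult.commute)
  qed
  then have "ennreal c * (x / ennreal c) \<le> ennreal c * (INF i\<in>I. ennreal (g i))"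
    by (rule mult_left_mono) simp
  moreover have "ennreal c * (x / ennreal c) = x"
    using assms(1) by (simp add: ennreal_times_divide mult.commute mult_divide_eq_ennreal)
  ultimately show ?thesis by simp
qed

lemma layer_cost_le_cmult:
  assumes "0 < \<theta>"
    "\<And>m. 0 < m \<Longrightarrow> layer_modular p q a m A \<le> 1 \<Longrightarrow> layer_modular p' q' a' (\<theta> * m) A' \<le> 1"
  shows "layer_cost p' q' a' A' \<le> ennreal \<theta> * layer_cost p q a A"
  unfolding layer_cost_def[of p q]
  by (rule ennreal_le_cmult_INF) (use assms in \<open>auto intro!: layer_cost_leI\<close>)

lemma lorentz_norm_le_cmultI:
  assumes "0 < c"
    "\<And>l. 0 < l \<Longrightarrow> (\<Sum>\<^sub>\<infinity>k. layer_cost p q (2 powi k) (superlevel f l k)) \<le> 1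
        \<Longrightarrow> N \<le> ennreal (c * l)"
  shows "N \<le> ennreal c * lorentz_norm p q f"
  unfolding lorentz_norm_altdef by (rule ennreal_le_cmult_INF) (use assms in auto)

text \<open>The set \<open>A\<^sub>k\<close> for the level \<open>2^j l\<close> is the set \<open>A\<^sub>k\<^sub>+\<^sub>j\<close> for the level \<open>l\<close>; renumbering the sum
  over all integers turns the height \<open>2^k\<close> of \<open>A\<^sub>k\<^sub>+\<^sub>j\<close> into the height \<open>2^(k-j)\<close> of \<open>A\<^sub>k\<close>.\<close>

lemma lorentz_norm_le_shift:
  assumes "0 < l"
    "(\<Sum>\<^sub>\<infinity>k. layer_cost p q (2 powi (k - j)) (superlevel f l k)) \<le> 1"
  shows "lorentz_norm p q f \<le> ennreal (2 powi j * l)"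
proof -
  have "(\<Sum>\<^sub>\<infinity>k. layer_cost p q (2 powi k) (superlevel f (2 powi j * l) k))
      = (\<Sum>\<^sub>\<infinity>k. layer_cost p q (2 powi ((k + j) - j)) (superlevel f l (k + j)))"
    using assms(1) by (simp add: superlevel_dilate)
  also have "\<dots> = (\<Sum>\<^sub>\<infinity>k. layer_cost p q (2 powi (k - j)) (superlevel f l k))"
    by (rule infsum_reindex_bij_betw[of "\<lambda>k. k + j" UNIV UNIV
          "\<lambda>k. layer_cost p q (2 powi (k - j)) (superlevel f l k)"])
       (auto intro: bij_betw_byWitness[of _ "\<lambda>k. k - j"])
  finally show ?thesis
    unfolding lorentz_norm_altdef using assms by (intro INF_lower) auto
qed

lemma infsum_ennreal_mono:
  fixes f g :: "'b \<Rightarrow> ennreal"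
  assumes "\<And>k. f k \<le> g k"
  shows "(\<Sum>\<^sub>\<infinity>k. f k) \<le> (\<Sum>\<^sub>\<infinity>k. g k)"
  by (rule infsum_mono) (auto intro: nonneg_summable_on_complete assms)

lemma term_le_infsum_ennreal:
  fixes f :: "'b \<Rightarrow> ennreal"
  shows "f k \<le> (\<Sum>\<^sub>\<infinity>k. f k)"
proof -
  have "f summable_on UNIV" by (intro nonneg_summable_on_complete) auto
  then show ?thesis using infsum_mono_neutral[of f "{k}" f UNIV] by simp
qed

section \<open>Absorbing constants\<close>

lemma powr_inverse_exponent_ge:
  assumes "0 < c" "ennreal c \<le> q" "0 \<le> s"
  shows "2 powr (- s) \<le> (2 powr (- s * c)) powr enn2real (inverse q)"
proof -
  have "s * (c * enn2real (inverse q)) \<le> s * 1"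
    using enn2real_inverse_le[OF assms(1,2)] assms
    by (intro mult_left_mono) (auto simp: field_simps)
  then show ?thesis by (simp add: powr_powr mult.assoc)
qed

lemma layer_modular_AE_mono:
  assumes "AE x in lebesgue. x \<in> A \<longrightarrow>
      exponent_phi (p' x) (a' / m' powr enn2real (inverse (q' x)))
        \<le> exponent_phi (p x) (a / m powr enn2real (inverse (q x)))"
  shows "layer_modular p' q' a' m' A \<le> layer_modular p q a m A"
  unfolding layer_modular_def
  by (rule nn_integral_mono_AE) (use assms in \<open>auto elim!: eventually_mono simp: indicator_def\<close>)

text \<open>If \<open>m\<close> is admissible at height \<open>a\<close>, then \<open>2^(-j c) m\<close> is admissible at height \<open>2^(-j) a\<close>:
  its power \<open>1/q \<le> 1/c\<close> loses at most the factor \<open>2^(-j)\<close> that the height has lost.\<close>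

lemma layer_cost_scale:
  assumes "0 < c" "AE x in lebesgue. ennreal c \<le> q x" "0 \<le> a"
  shows "layer_cost p q (2 powr (- real j) * a) A
           \<le> ennreal (2 powr (- real j * c)) * layer_cost p q a A"
proof (rule layer_cost_le_cmult)
  fix m :: real assume m: "0 < m" and le: "layer_modular p q a m A \<le> 1"
  have "layer_modular p q (2 powr (- real j) * a) (2 powr (- real j * c) * m) A
      \<le> layer_modular p q a m A"
  proof (rule layer_modular_AE_mono, use assms(2) in eventually_elim, rule impI, rule exponent_phi_mono)
    fix x assume "ennreal c \<le> q x"
    let ?r = "enn2real (inverse (q x))"
    have "2 powr (- real j) * a / (2 powr (- real j * c) * m) powr ?r
        = (2 powr (- real j) / (2 powr (- real j * c)) powr ?r) * (a / m powr ?r)"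
      using m by (simp add: powr_mult)
    also have "\<dots> \<le> 1 * (a / m powr ?r)"
      using powr_inverse_exponent_ge[OF assms(1) \<open>ennreal c \<le> q x\<close>, of "real j"] m assms(3)
      by (intro mult_right_mono) (auto simp: divide_le_eq)
    finally show "2 powr (- real j) * a / (2 powr (- real j * c) * m) powr ?r \<le> a / m powr ?r"
      by simp
  qed (use assms(3) in auto)
  then show "layer_modular p q (2 powr (- real j) * a) (2 powr (- real j * c) * m) A \<le> 1"
    using le by (rule order_trans)
qed simp

lemma summable_geometric_int:
  assumes "0 < \<epsilon>"
  shows "(\<lambda>k::int. 2 powr (- \<epsilon> * \<bar>real_of_int k\<bar>)) summable_on UNIV"
proof -
  have nat: "(\<lambda>n::nat. 2 powr (- \<epsilon> * n)) summable_on UNIV"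
  proof -
    have "summable (\<lambda>n. (2 powr (- \<epsilon>)) ^ n)"
      using assms powr_less_mono[of "- \<epsilon>" 0 2] by (intro summable_geometric) auto
    moreover have "(2 powr (- \<epsilon>)) ^ n = 2 powr (- \<epsilon> * n)" for n
      by (simp add: powr_realpow[symmetric] powr_powr)
    ultimately have "summable (\<lambda>n. 2 powr (- \<epsilon> * n))" by simp
    then show ?thesis by (intro norm_summable_imp_summable_on) simp
  qed
  have "(\<lambda>k::int. 2 powr (- \<epsilon> * \<bar>real_of_int k\<bar>)) summable_on range int"
    using nat by (subst summable_on_reindex) (auto simp: o_def)
  moreover have "(\<lambda>k::int. 2 powr (- \<epsilon> * \<bar>real_of_int k\<bar>)) summable_on range (\<lambda>n. - int n)"
    using nat by (subst summable_on_reindex) (auto simp: o_def inj_on_def)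
  ultimately have "(\<lambda>k::int. 2 powr (- \<epsilon> * \<bar>real_of_int k\<bar>)) summable_on range int \<union> range (\<lambda>n. - int n)"
    by (rule summable_on_union)
  moreover have "range int \<union> range (\<lambda>n. - int n) = UNIV"
  proof -
    have "k \<in> range int \<union> range (\<lambda>n. - int n)" for k
      by (cases k rule: int_cases2) auto
    then show ?thesis by blast
  qed
  ultimately show ?thesis by simp
qed

lemma infsum_ennreal_le:
  fixes g :: "'b \<Rightarrow> real"
  assumes "g summable_on UNIV" "\<And>k. 0 \<le> g k"
  shows "(\<Sum>\<^sub>\<infinity>k. ennreal (g k)) \<le> ennreal (\<Sum>\<^sub>\<infinity>k. g k)"
proof (rule infsum_le_finite_sums)
  fix F :: "'b set" assume "finite F"
  have "sum g F \<le> infsum g UNIV"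
    by (rule finite_sum_le_infsum) (use assms \<open>finite F\<close> in auto)
  then show "(\<Sum>k\<in>F. ennreal (g k)) \<le> ennreal (infsum g UNIV)"
    using assms by (simp add: ennreal_leI)
qed (auto intro: nonneg_summable_on_complete)

lemma exists_dyadic_decay:
  fixes B c :: real
  assumes "0 < c"
  obtains j :: nat where "2 powr (- real j * c) * B \<le> 1"
proof -
  have "(\<lambda>j. 2 powr (- real j * c) * B) \<longlonglongrightarrow> 0"
  proof -
    have "(\<lambda>j. (2 powr (- c)) ^ j) \<longlonglongrightarrow> 0"
      using assms powr_less_mono[of "- c" 0 2] by (intro LIMSEQ_realpow_zero) auto
    moreover have "(2 powr (- c)) ^ j = 2 powr (- real j * c)" for j
      by (simp add: powr_realpow[symmetric] powr_powr mult.commute)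
    ultimately show ?thesis by (auto intro: tendsto_mult_left_zero)
  qed
  then have "eventually (\<lambda>j. 2 powr (- real j * c) * B < 1) sequentially"
    by (rule order_tendstoD) simp
  then show ?thesis
    using that by (auto simp: eventually_sequentially intro: less_imp_le)
qed

lemma powi_diff_eq: "2 powi (k - int j) = 2 powr (- real j) * (2 powi k :: real)"
  by (simp add: power_int_diff powr_minus powr_realpow field_simps)

text \<open>The constant depends on \<open>q\<close> only through its lower bound, and neither on \<open>p\<close> nor on \<open>f\<close>: the
  costs have a finite total \<open>B\<close>, and \<open>j\<close> further halvings of the heights bring \<open>B\<close> below \<open>1\<close>.
  The parameter \<open>i\<close> allows heights that have been lowered already.\<close>

lemma lorentz_norm_le_of_geometric_costs:
  fixes q :: "'a::euclidean_space \<Rightarrow> ennreal"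
  assumes "0 < c" "AE x in lebesgue. ennreal c \<le> q x" "0 < \<epsilon>"
  obtains C where "0 < C"
    "\<And>p f l. 0 < l \<Longrightarrow>
       (\<And>k. layer_cost p q (2 powi (k - int i)) (superlevel f l k) \<le> ennreal (2 powr (- \<epsilon> * \<bar>real_of_int k\<bar>)))
       \<Longrightarrow> lorentz_norm p q f \<le> ennreal (C * l)"
proof -
  define B where "B = (\<Sum>\<^sub>\<infinity>k::int. 2 powr (- \<epsilon> * \<bar>real_of_int k\<bar>))"
  obtain j :: nat where j: "2 powr (- real j * c) * B \<le> 1"
    using exists_dyadic_decay[OF assms(1)] .
  have "lorentz_norm p q f \<le> ennreal (2 powi int (i + j) * l)"
    if l: "0 < l" and cost: "\<And>k. layer_cost p q (2 powi (k - int i)) (superlevel f l k)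
        \<le> ennreal (2 powr (- \<epsilon> * \<bar>real_of_int k\<bar>))" for p f l
  proof (rule lorentz_norm_le_shift[OF l])
    let ?\<theta> = "2 powr (- real j * c)"
    have "layer_cost p q (2 powi (k - int (i + j))) (superlevel f l k)
        \<le> ennreal (?\<theta> * 2 powr (- \<epsilon> * \<bar>real_of_int k\<bar>))" for k
    proof -
      have "2 powi (k - int (i + j)) = 2 powr (- real j) * (2 powi (k - int i) :: real)"
        using powi_diff_eq[of "k - int i" j] by (simp add: algebra_simps)
      then have "layer_cost p q (2 powi (k - int (i + j))) (superlevel f l k)
          \<le> ennreal ?\<theta> * layer_cost p q (2 powi (k - int i)) (superlevel f l k)"
        using layer_cost_scale[OF assms(1,2)] by simp
      also have "\<dots> \<le> ennreal ?\<theta> * ennreal (2 powr (- \<epsilon> * \<bar>real_of_int k\<bar>))"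
        by (intro mult_left_mono cost) simp
      finally show ?thesis by (simp add: ennreal_mult)
    qed
    then have "(\<Sum>\<^sub>\<infinity>k. layer_cost p q (2 powi (k - int (i + j))) (superlevel f l k))
        \<le> (\<Sum>\<^sub>\<infinity>k::int. ennreal (?\<theta> * 2 powr (- \<epsilon> * \<bar>real_of_int k\<bar>)))"
      by (rule infsum_ennreal_mono)
    also have "\<dots> \<le> ennreal (\<Sum>\<^sub>\<infinity>k::int. ?\<theta> * 2 powr (- \<epsilon> * \<bar>real_of_int k\<bar>))"
      by (rule infsum_ennreal_le)
         (use summable_on_cmult_right[OF summable_geometric_int[OF assms(3)]] in auto)
    also have "(\<Sum>\<^sub>\<infinity>k::int. ?\<theta> * 2 powr (- \<epsilon> * \<bar>real_of_int k\<bar>)) = ?\<theta> * B"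
      unfolding B_def by (rule infsum_cmult_right) (use summable_geometric_int[OF assms(3)] in simp)
    also have "ennreal (?\<theta> * B) \<le> 1" using j by (simp add: ennreal_le_1)
    finally show "(\<Sum>\<^sub>\<infinity>k. layer_cost p q (2 powi (k - int (i + j))) (superlevel f l k)) \<le> 1" .
  qed
  then show ?thesis using that[of "2 powi int (i + j)"] by simp
qed

section \<open>Enlarging the fine exponent\<close>

text \<open>For \<open>m < 1\<close> a larger \<open>q\<close> makes \<open>m^(1/q)\<close> larger, so admissible \<open>m\<close> stay admissible. For
  \<open>m > 1\<close> the monotonicity reverses, which is why the cost has to be less than \<open>1\<close>.\<close>

lemma layer_cost_antimono_exponent:
  assumes "\<And>x. 0 < q0 x" "\<And>x. q0 x \<le> q1 x" "0 \<le> a" "layer_cost p q0 a A < 1"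
  shows "layer_cost p q1 a A \<le> layer_cost p q0 a A"
proof (rule dense_ge)
  fix b assume "layer_cost p q0 a A < b"
  then have "layer_cost p q0 a A < min b 1" using assms(4) by simp
  then obtain m where m: "0 < m" "ennreal m < min b 1" "layer_modular p q0 a m A \<le> 1"
    by (rule layer_cost_lessE)
  have m1: "m < 1" using m by (simp add: ennreal_less_one_iff)
  have "layer_modular p q1 a m A \<le> layer_modular p q0 a m A"
  proof (rule layer_modular_AE_mono, rule AE_I2, rule impI, rule exponent_phi_mono)
    fix x
    have "enn2real (inverse (q1 x)) \<le> enn2real (inverse (q0 x))"
      using assms(1,2) by (rule enn2real_inverse_antimono)
    then have "m powr enn2real (inverse (q0 x)) \<le> m powr enn2real (inverse (q1 x))"
      using m m1 by (intro powr_mono') auto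
    then show "a / m powr enn2real (inverse (q1 x)) \<le> a / m powr enn2real (inverse (q0 x))"
      using assms(3) m by (intro divide_left_mono) auto
  qed (use assms in auto)
  then have "layer_cost p q1 a A \<le> ennreal m"
    using m by (intro layer_cost_leI) auto
  then show "layer_cost p q1 a A \<le> b" using m by auto
qed

text \<open>The constant \<open>2\<close> comes from one halving of the heights: it multiplies the costs, each at
  most \<open>1\<close>, by \<open>2^(-c) < 1\<close> and thus puts them strictly below \<open>1\<close>.\<close>

lemma lorentz_norm_mono_fine_exponent:
  assumes "q0 \<in> variable_exponents" "\<And>x. q0 x \<le> q1 x"
  shows "lorentz_norm p q1 f \<le> ennreal 2 * lorentz_norm p q0 f"
proof (rule lorentz_norm_le_cmultI)
  fix l :: real
  assume l: "0 < l" and le: "(\<Sum>\<^sub>\<infinity>k. layer_cost p q0 (2 powi k) (superlevel f l k)) \<le> 1"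
  obtain c where c: "0 < c" "AE x in lebesgue. ennreal c \<le> q0 x"
    using variable_exponent_lower_bound[OF assms(1)] .
  have lt1: "2 powr (- c) < 1" using c(1) powr_less_mono[of "- c" 0 2] by simp
  have "layer_cost p q1 (2 powi (k - 1)) (superlevel f l k)
      \<le> layer_cost p q0 (2 powi k) (superlevel f l k)" for k
  proof -
    let ?A = "superlevel f l k"
    have eq: "2 powi (k - 1) = 2 powi k / (2::real)" using powi_diff_eq[of k 1] by simp
    have scale: "layer_cost p q0 (2 powi (k - 1)) ?A \<le> ennreal (2 powr (- c)) * layer_cost p q0 (2 powi k) ?A"
      unfolding eq using layer_cost_scale[OF c, of "2 powi k" p 1 ?A] by simp
    also have "\<dots> \<le> ennreal (2 powr (- c)) * 1"
      by (intro mult_left_mono order_trans[OF term_le_infsum_ennreal le]) simp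
    also have "\<dots> < 1" using lt1 by (simp add: ennreal_less_one_iff)
    finally have lt: "layer_cost p q0 (2 powi (k - 1)) ?A < 1" .
    have "layer_cost p q1 (2 powi (k - 1)) ?A \<le> layer_cost p q0 (2 powi (k - 1)) ?A"
      using layer_cost_antimono_exponent[OF _ assms(2) _ lt] variable_exponentsD[OF assms(1)] by simp
    also have "\<dots> \<le> ennreal (2 powr (- c)) * layer_cost p q0 (2 powi k) ?A"
      by (rule scale)
    also have "\<dots> \<le> 1 * layer_cost p q0 (2 powi k) ?A"
      using lt1 by (intro mult_right_mono) (auto simp: ennreal_le_1)
    finally show ?thesis by simp
  qed
  then have "(\<Sum>\<^sub>\<infinity>k. layer_cost p q1 (2 powi (k - 1)) (superlevel f l k)) \<le> 1"
    by (rule order_trans[OF infsum_ennreal_mono le])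
  from lorentz_norm_le_shift[OF l this] show "lorentz_norm p q1 f \<le> ennreal (2 * l)" by simp
qed simp

section \<open>Infinite integrability exponent\<close>

text \<open>A sum of costs at most \<open>1\<close> gives every layer an admissible \<open>m < 2\<close>, and then
  \<open>m^(1/q) \<le> 2^(1/c)\<close>. Once \<open>k > 1/c\<close>, the height \<open>2^k / m^(1/q)\<close> exceeds \<open>1\<close>, where \<open>\<phi>\<^sub>\<infinity>\<close> is infinite;
  so the layer is a null set.\<close>

lemma Linf_norm_le_lorentz_norm:
  fixes q :: "'a::euclidean_space \<Rightarrow> ennreal"
  assumes "q \<in> variable_exponents"
  obtains C where "0 < C"
    "\<And>f. f \<in> borel_measurable lebesgue \<Longrightarrow> Linf_norm f \<le> ennreal C * lorentz_norm (\<lambda>_. \<infinity>) q f"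
proof -
  obtain c where c: "0 < c" "AE x in lebesgue. ennreal c \<le> q x"
    using variable_exponent_lower_bound[OF assms] .
  obtain k :: nat where k: "1 / c < k" using reals_Archimedean2 by blast
  have "Linf_norm f \<le> ennreal (2 ^ k) * lorentz_norm (\<lambda>_. \<infinity>) q f"
    if f [measurable]: "f \<in> borel_measurable lebesgue" for f
  proof (rule lorentz_norm_le_cmultI)
    fix l :: real
    assume l: "0 < l"
      and le: "(\<Sum>\<^sub>\<infinity>k. layer_cost (\<lambda>_. \<infinity>) q (2 powi k) (superlevel f l k)) \<le> 1"
    let ?A = "superlevel f l (int k)"
    have "layer_cost (\<lambda>_. \<infinity>) q (2 powi int k) ?A < ennreal 2"
      by (rule le_less_trans[OF order_trans[OF term_le_infsum_ennreal le]]) simp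
    then obtain m where m: "0 < m" "m < 2" "layer_modular (\<lambda>_. \<infinity>) q (2 powi int k) m ?A \<le> 1"
      by (auto elim!: layer_cost_lessE simp: ennreal_less_iff)
    have [measurable]: "q \<in> borel_measurable lebesgue" using variable_exponentsD[OF assms] by simp
    have "AE x in lebesgue. exponent_phi \<infinity> (2 powi int k / m powr enn2real (inverse (q x)))
        * indicator ?A x \<noteq> \<infinity>"
    proof (rule nn_integral_PInf_AE)
      show "(\<integral>\<^sup>+x. exponent_phi \<infinity> (2 powi int k / m powr enn2real (inverse (q x)))
          * indicator ?A x \<partial>lebesgue) \<noteq> \<infinity>"
        using m(3) by (auto simp: layer_modular_def top_unique)
    qed measurable
    then have "AE x in lebesgue. cmod (f x) \<le> 2 ^ k * l"
      using c(2)
    proof eventually_elim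
      fix x assume ne: "exponent_phi \<infinity> (2 powi int k / m powr enn2real (inverse (q x)))
        * indicator ?A x \<noteq> \<infinity>" and "ennreal c \<le> q x"
      have r: "enn2real (inverse (q x)) < k"
        using enn2real_inverse_le[OF c(1) \<open>ennreal c \<le> q x\<close>] k by simp
      have "m powr enn2real (inverse (q x)) \<le> 2 powr enn2real (inverse (q x))"
        using m by (intro powr_mono2) auto
      also have "\<dots> < 2 powr k" using r by simp
      finally have "m powr enn2real (inverse (q x)) < 2 ^ k" by (simp add: powr_realpow)
      then have "1 < 2 powi int k / m powr enn2real (inverse (q x))" using m by simp
      then have "x \<notin> ?A" using ne by (auto simp: exponent_phi_def)
      then show "cmod (f x) \<le> 2 ^ k * l"
        using l by (simp add: superlevel_def norm_divide field_simps)
    qed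
    then show "Linf_norm f \<le> ennreal (2 ^ k * l)"
      unfolding Linf_norm_def
      by (intro esssup_I) (auto elim!: eventually_mono intro: ennreal_leI)
  qed simp
  then show ?thesis using that[of "2 ^ k"] by simp
qed

text \<open>At a level \<open>l \<ge> Linf_norm f\<close> the layers with \<open>k \<ge> 0\<close> are null sets, and for \<open>k < 0\<close> the number
  \<open>m = 2^(-c|k|)\<close> is admissible because \<open>m^(1/q) \<ge> 2^k\<close>. Levels have to be positive, so the
  bound is taken along levels decreasing to \<open>Linf_norm f\<close>, which also covers \<open>Linf_norm f = 0\<close>.\<close>

lemma lorentz_norm_le_Linf_norm:
  fixes q :: "'a::euclidean_space \<Rightarrow> ennreal"
  assumes "q \<in> variable_exponents"
  obtains C where "0 < C"
    "\<And>f. f \<in> borel_measurable lebesgue \<Longrightarrow> lorentz_norm (\<lambda>_. \<infinity>) q f \<le> ennreal C * Linf_norm f"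
proof -
  obtain c where c: "0 < c" "AE x in lebesgue. ennreal c \<le> q x"
    using variable_exponent_lower_bound[OF assms] .
  obtain C where C: "0 < C" and geom:
    "\<And>p f l. 0 < l \<Longrightarrow>
       (\<And>k. layer_cost p q (2 powi k) (superlevel f l k) \<le> ennreal (2 powr (- c * \<bar>real_of_int k\<bar>)))
       \<Longrightarrow> lorentz_norm p q f \<le> ennreal (C * l)"
    using lorentz_norm_le_of_geometric_costs[OF c c(1), of 0] by (metis diff_zero of_nat_0)
  have "lorentz_norm (\<lambda>_. \<infinity>) q f \<le> ennreal C * Linf_norm f"
    if f: "f \<in> borel_measurable lebesgue" for f
  proof -
    have bound: "lorentz_norm (\<lambda>_. \<infinity>) q f \<le> ennreal C * ennreal l"
      if l: "0 < l" "Linf_norm f \<le> ennreal l" for l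
    proof -
      have ae: "AE x in lebesgue. cmod (f x) \<le> l"
        using esssup_AE[of "\<lambda>x. ennreal (cmod (f x))" lebesgue]
      proof eventually_elim
        fix x assume "ennreal (cmod (f x)) \<le> esssup lebesgue (\<lambda>x. ennreal (cmod (f x)))"
        then have "ennreal (cmod (f x)) \<le> ennreal l"
          using l(2) unfolding Linf_norm_def by (rule order_trans)
        then show "cmod (f x) \<le> l" using l by simp
      qed
      have "layer_cost (\<lambda>_. \<infinity>) q (2 powi k) (superlevel f l k) \<le> ennreal (2 powr (- c * \<bar>real_of_int k\<bar>))"
        for k :: int
      proof (rule layer_cost_leI)
        let ?m = "2 powr (- c * \<bar>real_of_int k\<bar>)"
        have "AE x in lebesgue. exponent_phi \<infinity> (2 powi k / ?m powr enn2real (inverse (q x)))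
            * indicator (superlevel f l k) x = 0"
          using ae c(2)
        proof eventually_elim
          fix x assume fx: "cmod (f x) \<le> l" and q: "ennreal c \<le> q x"
          show "exponent_phi \<infinity> (2 powi k / ?m powr enn2real (inverse (q x)))
              * indicator (superlevel f l k) x = 0"
          proof (cases "k < 0")
            case False
            then have "1 \<le> (2::real) powi k" by (simp add: one_le_power_int)
            moreover have "cmod (f x) / l \<le> 1" using fx l by simp
            ultimately have "\<not> 2 powi k < cmod (f x) / l" by linarith
            then have "x \<notin> superlevel f l k"
              using l by (simp add: superlevel_def norm_divide)
            then show ?thesis by simp
          next
            case True
            have "2 powi k = (2::real) powr (- \<bar>real_of_int k\<bar>)"
              using True by (simp add: powr_real_of_int')
            also have "\<dots> \<le> (2 powr (- \<bar>real_of_int k\<bar> * c)) powr enn2real (inverse (q x))"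
              by (rule powr_inverse_exponent_ge[OF c(1) q]) simp
            finally have "2 powi k / ?m powr enn2real (inverse (q x)) \<le> 1"
              by (simp add: mult.commute)
            then show ?thesis by (simp add: exponent_phi_def)
          qed
        qed
        then have "layer_modular (\<lambda>_. \<infinity>) q (2 powi k) ?m (superlevel f l k) = (\<integral>\<^sup>+x. 0 \<partial>(lebesgue :: 'a measure))"
          unfolding layer_modular_def by (rule nn_integral_cong_AE)
        then show "layer_modular (\<lambda>_. \<infinity>) q (2 powi k) ?m (superlevel f l k) \<le> 1" by simp
      qed simp
      from geom[OF l(1) this] show ?thesis using C l by (simp add: ennreal_mult)
    qed
    show ?thesis
    proof (cases "Linf_norm f")
      case top
      then show ?thesis using C by (simp add: ennreal_mult_top)
    next
      case (real M)
      show ?thesis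
      proof (rule ennreal_le_epsilon)
        fix e :: real assume e: "0 < e"
        have "Linf_norm f \<le> ennreal (M + e / C)" using real e C by (simp add: ennreal_leI)
        moreover have "0 < M + e / C" using real e C by (simp add: add_nonneg_pos)
        ultimately have "lorentz_norm (\<lambda>_. \<infinity>) q f \<le> ennreal C * ennreal (M + e / C)"
          by (intro bound)
        also have "\<dots> = ennreal C * Linf_norm f + ennreal e"
          using real e C by (simp add: ennreal_mult[symmetric] ennreal_plus[symmetric] field_simps
              del: ennreal_plus)
        finally show "lorentz_norm (\<lambda>_. \<infinity>) q f \<le> ennreal C * Linf_norm f + ennreal e" .
      qed
    qed
  qed
  then show ?thesis using that C by blast
qed

section \<open>Functions supported on a set of finite measure\<close>

text \<open>Keeping \<open>m\<close> fixed and lowering the height turns a bound on the modular by a constant into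
  admissibility of \<open>m\<close>.\<close>

lemma layer_modular_shrink:
  assumes p: "p \<in> borel_measurable lebesgue" "0 < c" "AE x in lebesgue. ennreal c \<le> p x"
    and q: "q \<in> borel_measurable lebesgue" and A: "A \<in> sets lebesgue"
    and a: "0 \<le> a" and m: "0 < m"
    and B: "layer_modular p q a m A \<le> ennreal B" "2 powr (- real i * c) * B \<le> 1"
  shows "layer_modular p q (2 powr (- real i) * a) m A \<le> 1"
proof -
  let ?\<theta> = "2 powr (- real i)"
  have "layer_modular p q (?\<theta> * a) m A
      \<le> (\<integral>\<^sup>+x. ennreal (?\<theta> powr c) *
          (exponent_phi (p x) (a / m powr enn2real (inverse (q x))) * indicator A x) \<partial>lebesgue)"
    unfolding layer_modular_def
  proof (rule nn_integral_mono_AE, use p(3) in eventually_elim)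
    fix x assume "ennreal c \<le> p x"
    have "?\<theta> \<le> 1" using powr_mono[of "- real i" 0 2] by simp
    with exponent_phi_scale[OF p(2) \<open>ennreal c \<le> p x\<close>, of ?\<theta> "a / m powr enn2real (inverse (q x))"]
    show "exponent_phi (p x) (?\<theta> * a / m powr enn2real (inverse (q x))) * indicator A x
        \<le> ennreal (?\<theta> powr c) *
          (exponent_phi (p x) (a / m powr enn2real (inverse (q x))) * indicator A x)"
      using a m by (auto simp: indicator_def)
  qed
  also have "\<dots> = ennreal (?\<theta> powr c) * layer_modular p q a m A"
    unfolding layer_modular_def using p(1) q A by (intro nn_integral_cmult) measurable
  also have "\<dots> \<le> ennreal (?\<theta> powr c) * ennreal B"
    by (intro mult_left_mono B) simp
  also have "\<dots> = ennreal (2 powr (- real i * c) * B)"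
    by (simp add: ennreal_mult' powr_powr)
  also have "\<dots> \<le> 1" using B(2) by (simp add: ennreal_le_1)
  finally show ?thesis .
qed

lemma layer_modular_le_measure_add:
  assumes meas: "p1 \<in> borel_measurable lebesgue" "q1 \<in> borel_measurable lebesgue"
      "A \<in> sets lebesgue" "S \<in> sets lebesgue"
    and A: "AE x in lebesgue. x \<in> A \<longrightarrow> x \<in> S"
    and p: "AE x in lebesgue. ennreal \<alpha> * p0 x \<le> p1 x" "1 \<le> \<alpha>"
    and am: "0 \<le> a0" "0 \<le> a1"
    and t: "AE x in lebesgue. a0 / m0 powr enn2real (inverse (q0 x))
              \<le> max 1 ((a1 / m1 powr enn2real (inverse (q1 x))) powr \<alpha>)"
  shows "layer_modular p0 q0 a0 m0 A \<le> emeasure lebesgue S + layer_modular p1 q1 a1 m1 A"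
proof -
  have "layer_modular p0 q0 a0 m0 A \<le>
      (\<integral>\<^sup>+x. indicator S x +
        exponent_phi (p1 x) (a1 / m1 powr enn2real (inverse (q1 x))) * indicator A x \<partial>lebesgue)"
    unfolding layer_modular_def
  proof (rule nn_integral_mono_AE, use A p(1) t in eventually_elim)
    fix x
    assume "x \<in> A \<longrightarrow> x \<in> S" "ennreal \<alpha> * p0 x \<le> p1 x"
      "a0 / m0 powr enn2real (inverse (q0 x))
              \<le> max 1 ((a1 / m1 powr enn2real (inverse (q1 x))) powr \<alpha>)"
    with exponent_phi_le_add_one[OF _ _ this(3) p(2) this(2)] am
    show "exponent_phi (p0 x) (a0 / m0 powr enn2real (inverse (q0 x))) * indicator A x
        \<le> indicator S x +
        exponent_phi (p1 x) (a1 / m1 powr enn2real (inverse (q1 x))) * indicator A x"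
      by (auto simp: indicator_def)
  qed
  also have "\<dots> = emeasure lebesgue S + layer_modular p1 q1 a1 m1 A"
    unfolding layer_modular_def using meas by (subst nn_integral_add) auto
  finally show ?thesis .
qed

lemma AE_superlevel_subset:
  assumes "AE x in M. x \<notin> S \<longrightarrow> f x = 0"
  shows "AE x in M. x \<in> superlevel f l k \<longrightarrow> x \<in> S"
proof -
  have "x \<notin> superlevel f l k" if "f x = 0" for x
    using that by (simp add: superlevel_def not_less)
  then show ?thesis using assms by (auto elim!: eventually_mono)
qed

text \<open>Any \<open>m\<close> admissible for \<open>p1\<close> has a modular for \<open>p0\<close> of at most \<open>|S| + 1\<close>, so the same \<open>m\<close> is
  admissible for \<open>p0\<close> after lowering the heights by a constant factor. The costs are thus
  compared layer by layer.\<close>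

lemma lorentz_norm_mono_exponent_finite_measure:
  fixes p0 p1 q :: "'a::euclidean_space \<Rightarrow> ennreal"
  assumes "p0 \<in> variable_exponents" "p1 \<in> variable_exponents" "q \<in> variable_exponents"
    and le: "\<And>x. p0 x \<le> p1 x"
    and S: "S \<in> sets lebesgue" "emeasure lebesgue S < \<infinity>"
  obtains C where "0 < C"
    "\<And>f. f \<in> borel_measurable lebesgue \<Longrightarrow> AE x in lebesgue. x \<notin> S \<longrightarrow> f x = 0 \<Longrightarrow>
       lorentz_norm p0 q f \<le> ennreal C * lorentz_norm p1 q f"
proof -
  note meas [measurable] = variable_exponentsD(1)[OF assms(1)] variable_exponentsD(1)[OF assms(2)]
    variable_exponentsD(1)[OF assms(3)]
  obtain c where c: "0 < c" "AE x in lebesgue. ennreal c \<le> p0 x"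
    using variable_exponent_lower_bound[OF assms(1)] .
  define B where "B = measure lebesgue S + 1"
  have B: "emeasure lebesgue S + 1 = ennreal B"
    using S(2) by (simp add: B_def emeasure_eq_ennreal_measure less_top)
  obtain i :: nat where i: "2 powr (- real i * c) * B \<le> 1"
    using exists_dyadic_decay[OF c(1)] .
  have "lorentz_norm p0 q f \<le> ennreal (2 ^ i) * lorentz_norm p1 q f"
    if f [measurable]: "f \<in> borel_measurable lebesgue" and supp: "AE x in lebesgue. x \<notin> S \<longrightarrow> f x = 0"
    for f
  proof (rule lorentz_norm_le_cmultI)
    fix l :: real
    assume l: "0 < l" and sum: "(\<Sum>\<^sub>\<infinity>k. layer_cost p1 q (2 powi k) (superlevel f l k)) \<le> 1"
    have "layer_cost p0 q (2 powi (k - int i)) (superlevel f l k)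
        \<le> ennreal 1 * layer_cost p1 q (2 powi k) (superlevel f l k)" for k
    proof (rule layer_cost_le_cmult)
      fix m :: real assume m: "0 < m" and le1: "layer_modular p1 q (2 powi k) m (superlevel f l k) \<le> 1"
      have "layer_modular p0 q (2 powi k) m (superlevel f l k)
          \<le> emeasure lebesgue S + layer_modular p1 q (2 powi k) m (superlevel f l k)"
        by (rule layer_modular_le_measure_add[where \<alpha> = 1])
           (use S le AE_superlevel_subset[OF supp] in auto)
      also have "\<dots> \<le> emeasure lebesgue S + 1" by (intro add_left_mono le1)
      finally have "layer_modular p0 q (2 powi k) m (superlevel f l k) \<le> ennreal B" using B by simp
      from layer_modular_shrink[OF _ c _ _ _ m this i]
      show "layer_modular p0 q (2 powi (k - int i)) (1 * m) (superlevel f l k) \<le> 1"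
        by (simp add: powi_diff_eq)
    qed simp
    then have "(\<Sum>\<^sub>\<infinity>k. layer_cost p0 q (2 powi (k - int i)) (superlevel f l k)) \<le> 1"
      by (intro order_trans[OF infsum_ennreal_mono sum]) simp
    from lorentz_norm_le_shift[OF l this]
    show "lorentz_norm p0 q f \<le> ennreal (2 ^ i * l)" by simp
  qed simp
  then show ?thesis using that[of "2 ^ i"] by simp
qed

text \<open>Only the bound \<open>1\<close> on each single cost for \<open>p1\<close>, \<open>q1\<close> enters, which is the reason that \<open>q0\<close> and
  \<open>q1\<close> are unrelated. It gives an \<open>m < 2\<close> and hence a modular for \<open>p1\<close> at most \<open>1\<close> at a height
  \<open>u \<ge> 2^(k - 1/d1)\<close>. Since \<open>p1 \<ge> \<alpha> p0\<close>, heights up to \<open>u^\<alpha>\<close> are affordable for \<open>p0\<close>, and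
  for \<open>k > 0\<close> the excess \<open>2^((\<alpha>-1) k)\<close> pays for dividing by \<open>(2^(-\<epsilon> k))^(1/q0)\<close>. For \<open>k \<le> 0\<close> heights
  up to \<open>1\<close> are affordable, because the measure of \<open>S\<close> is finite.\<close>

lemma lorentz_norm_le_larger_exponent_finite_measure:
  fixes p0 p1 q0 q1 :: "'a::euclidean_space \<Rightarrow> ennreal"
  assumes "p0 \<in> variable_exponents" "p1 \<in> variable_exponents"
      "q0 \<in> variable_exponents" "q1 \<in> variable_exponents"
    and \<alpha>: "1 < \<alpha>" "AE x in lebesgue. ennreal \<alpha> * p0 x \<le> p1 x"
    and S: "S \<in> sets lebesgue" "emeasure lebesgue S < \<infinity>"
  obtains C where "0 < C"
    "\<And>f. f \<in> borel_measurable lebesgue \<Longrightarrow> AE x in lebesgue. x \<notin> S \<longrightarrow> f x = 0 \<Longrightarrow>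
       lorentz_norm p0 q0 f \<le> ennreal C * lorentz_norm p1 q1 f"
proof -
  note meas [measurable] = variable_exponentsD(1)[OF assms(1)] variable_exponentsD(1)[OF assms(2)]
    variable_exponentsD(1)[OF assms(3)] variable_exponentsD(1)[OF assms(4)]
  obtain c where c: "0 < c" "AE x in lebesgue. ennreal c \<le> p0 x"
    using variable_exponent_lower_bound[OF assms(1)] .
  obtain d0 where d0: "0 < d0" "AE x in lebesgue. ennreal d0 \<le> q0 x"
    using variable_exponent_lower_bound[OF assms(3)] .
  obtain d1 where d1: "0 < d1" "AE x in lebesgue. ennreal d1 \<le> q1 x"
    using variable_exponent_lower_bound[OF assms(4)] .
  define B where "B = measure lebesgue S + 1"
  have B: "emeasure lebesgue S + 1 = ennreal B"
    using S(2) by (simp add: B_def emeasure_eq_ennreal_measure less_top)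
  obtain i :: nat where i: "2 powr (- real i * c) * B \<le> 1"
    using exists_dyadic_decay[OF c(1)] .
  \<comment> \<open>These \<open>j\<close> halvings compensate the factor \<open>2^(\<alpha>/d1)\<close> lost in \<open>u^\<alpha>\<close> through \<open>m < 2\<close>.\<close>
  obtain j :: nat where j: "\<alpha> / d1 \<le> j" using real_arch_simple by blast
  \<comment> \<open>Then \<open>\<epsilon> / q0\<close> is at most \<open>\<alpha> - 1\<close>, as needed for \<open>k > 0\<close>, and at most \<open>1\<close>, as needed for
    \<open>k < 0\<close>.\<close>
  define \<epsilon> where "\<epsilon> = d0 * min 1 (\<alpha> - 1)"
  have \<epsilon>: "0 < \<epsilon>" using d0 \<alpha> by (simp add: \<epsilon>_def)
  obtain C where C: "0 < C" and geom:
    "\<And>p f l. 0 < l \<Longrightarrow> (\<And>k. layer_cost p q0 (2 powi (k - int (j + i))) (superlevel f l k)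
         \<le> ennreal (2 powr (- \<epsilon> * \<bar>real_of_int k\<bar>))) \<Longrightarrow> lorentz_norm p q0 f \<le> ennreal (C * l)"
    using lorentz_norm_le_of_geometric_costs[OF d0 \<epsilon>, of "j + i"] by metis
  have "lorentz_norm p0 q0 f \<le> ennreal C * lorentz_norm p1 q1 f"
    if f [measurable]: "f \<in> borel_measurable lebesgue" and supp: "AE x in lebesgue. x \<notin> S \<longrightarrow> f x = 0"
    for f
  proof (rule lorentz_norm_le_cmultI[OF C])
    fix l :: real
    assume l: "0 < l" and sum: "(\<Sum>\<^sub>\<infinity>k. layer_cost p1 q1 (2 powi k) (superlevel f l k)) \<le> 1"
    show "lorentz_norm p0 q0 f \<le> ennreal (C * l)"
    proof (rule geom[OF l], rule layer_cost_leI)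
      fix k :: int
      let ?A = "superlevel f l k"
      let ?n = "2 powr (- \<epsilon> * \<bar>real_of_int k\<bar>)"
      have "layer_cost p1 q1 (2 powi k) ?A < ennreal 2"
        by (rule le_less_trans[OF order_trans[OF term_le_infsum_ennreal sum]]) simp
      then obtain m where m: "0 < m" "m < 2" and le1: "layer_modular p1 q1 (2 powi k) m ?A \<le> 1"
        by (auto elim!: layer_cost_lessE simp: ennreal_less_iff)
      have "AE x in lebesgue. 2 powi (k - int j) / ?n powr enn2real (inverse (q0 x))
              \<le> max 1 ((2 powi k / m powr enn2real (inverse (q1 x))) powr \<alpha>)"
        using d0(2) d1(2)
      proof eventually_elim
        fix x assume q0: "ennreal d0 \<le> q0 x" and q1: "ennreal d1 \<le> q1 x"
        define r0 where "r0 = enn2real (inverse (q0 x))"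
        define r1 where "r1 = enn2real (inverse (q1 x))"
        have r0: "0 \<le> r0" "r0 \<le> 1 / d0"
          using enn2real_inverse_le[OF d0(1) q0] by (auto simp: r0_def)
        have r1: "0 \<le> r1" "r1 \<le> 1 / d1"
          using enn2real_inverse_le[OF d1(1) q1] by (auto simp: r1_def)
        have er: "\<epsilon> * r0 \<le> min 1 (\<alpha> - 1)"
        proof -
          have "\<epsilon> * r0 \<le> \<epsilon> * (1 / d0)" using r0 \<epsilon> by (intro mult_left_mono) auto
          then show ?thesis using d0 by (simp add: \<epsilon>_def)
        qed
        have t: "2 powi (k - int j) / ?n powr r0 = 2 powr (k - real j + \<epsilon> * r0 * \<bar>real_of_int k\<bar>)"
        proof -
          have "2 powi (k - int j) = (2::real) powr (k - real j)"
            using powr_real_of_int'[of 2 "k - int j"] by simp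
          moreover have "?n powr r0 = 2 powr (- (\<epsilon> * r0 * \<bar>real_of_int k\<bar>))"
            by (simp add: powr_powr mult_ac)
          ultimately show ?thesis by (simp only: powr_diff[symmetric] diff_minus_eq_add)
        qed
        show "2 powi (k - int j) / ?n powr r0 \<le> max 1 ((2 powi k / m powr r1) powr \<alpha>)"
        proof (cases "k - real j + \<epsilon> * r0 * \<bar>real_of_int k\<bar> \<le> 0")
          case True
          then have "2 powr (k - real j + \<epsilon> * r0 * \<bar>real_of_int k\<bar>) \<le> 2 powr 0" by (intro powr_mono) auto
          then show ?thesis unfolding t by simp
        next
          case False
          have k: "0 \<le> k"
          proof (rule ccontr)
            assume "\<not> 0 \<le> k"
            moreover have "\<epsilon> * r0 * \<bar>real_of_int k\<bar> \<le> 1 * \<bar>real_of_int k\<bar>"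
              using er by (intro mult_right_mono) auto
            moreover have "real_of_int k < 0" using \<open>\<not> 0 \<le> k\<close> by simp
            ultimately show False using False by linarith
          qed
          have "\<epsilon> * r0 * k \<le> (\<alpha> - 1) * k" using er k by (intro mult_right_mono) auto
          moreover have "\<alpha> * r1 \<le> j"
          proof -
            have "\<alpha> * r1 \<le> \<alpha> * (1 / d1)" using r1 \<alpha> by (intro mult_left_mono) auto
            then show ?thesis using j by simp
          qed
          ultimately have "k - real j + \<epsilon> * r0 * \<bar>real_of_int k\<bar> \<le> (k - r1) * \<alpha>"
            using k by (simp add: algebra_simps)
          then have "2 powr (k - real j + \<epsilon> * r0 * \<bar>real_of_int k\<bar>) \<le> 2 powr ((k - r1) * \<alpha>)"
            by (intro powr_mono) auto
          also have "\<dots> = (2 powi k / 2 powr r1) powr \<alpha>"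
            by (simp add: powr_powr flip: powr_diff powr_real_of_int')
          also have "\<dots> \<le> (2 powi k / m powr r1) powr \<alpha>"
            using m r1 \<alpha> by (intro powr_mono2 divide_left_mono) auto
          finally show ?thesis unfolding t by simp
        qed
      qed
      then have "layer_modular p0 q0 (2 powi (k - int j)) ?n ?A
          \<le> emeasure lebesgue S + layer_modular p1 q1 (2 powi k) m ?A"
        using \<alpha> S AE_superlevel_subset[OF supp]
        by (intro layer_modular_le_measure_add[where \<alpha> = \<alpha>]) auto
      also have "\<dots> \<le> emeasure lebesgue S + 1" by (intro add_left_mono le1)
      finally have "layer_modular p0 q0 (2 powi (k - int j)) ?n ?A \<le> ennreal B" using B by simp
      from layer_modular_shrink[OF _ c _ _ _ _ this i]
      show "layer_modular p0 q0 (2 powi (k - int (j + i))) ?n ?A \<le> 1"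
        using powi_diff_eq[of "k - int j" i] by (simp add: algebra_simps)
    qed simp
  qed
  then show ?thesis using that C by blast
qed

section \<open>Essential support and the unit cube\<close>

text \<open>The largest open set of vanishing is a possibly uncountable union of open sets; by Lindelof's
  theorem countably many of them already cover it, so the exceptional null sets add up to a null
  set.\<close>

lemma AE_zero_outside_ess_support:
  "AE x in lebesgue. x \<notin> ess_support f \<longrightarrow> f x = 0"
proof -
  define \<U> where "\<U> = {U. open U \<and> (AE x in lebesgue. x \<in> U \<longrightarrow> f x = 0)}"
  obtain \<V> where \<V>: "\<V> \<subseteq> \<U>" "countable \<V>" "\<Union>\<V> = \<Union>\<U>"
    using Lindelof[of \<U>] by (auto simp: \<U>_def)
  have "AE x in lebesgue. \<forall>U\<in>\<V>. x \<in> U \<longrightarrow> f x = 0"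
    using \<V> by (subst AE_ball_countable) (auto simp: \<U>_def)
  then show ?thesis
  proof eventually_elim
    fix x assume "\<forall>U\<in>\<V>. x \<in> U \<longrightarrow> f x = 0"
    then show "x \<notin> ess_support f \<longrightarrow> f x = 0"
      using \<V>(3) by (auto simp: ess_support_def \<U>_def[symmetric])
  qed
qed

lemma unit_cube_eq_cbox: "unit_cube = cbox 0 (1 :: real^'n)"
  by (auto simp: unit_cube_def mem_box_cart)

lemma AE_zero_outside_cube:
  fixes f :: "real^'n \<Rightarrow> complex"
  assumes "ess_support f \<subseteq> unit_cube"
  shows "AE x in lebesgue. x \<notin> cbox 0 1 \<longrightarrow> f x = 0"
  using AE_zero_outside_ess_support[of f] assms
  by (auto elim!: eventually_mono simp: unit_cube_eq_cbox)

theorem theorem7: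
  shows
   "(\<forall>p q0 q1 :: real^'n \<Rightarrow> ennreal.
       p \<in> variable_exponents \<and> q0 \<in> variable_exponents \<and> q1 \<in> variable_exponents \<and>
       (\<forall>x. q0 x \<le> q1 x) \<longrightarrow>
       continuously_embedded (lorentz_space p q0) (lorentz_norm p q0)
                             (lorentz_space p q1) (lorentz_norm p q1))
    \<and>
    (\<forall>q :: real^'n \<Rightarrow> ennreal.
       q \<in> variable_exponents \<longrightarrow>
       equal_with_equivalent_norms (lorentz_space (\<lambda>_. \<infinity>) q) (lorentz_norm (\<lambda>_. \<infinity>) q)
                                   Linf_space Linf_norm)
    \<and>
    (\<forall>p0 p1 q0 q1 :: real^'n \<Rightarrow> ennreal.
       p0 \<in> variable_exponents \<and> p1 \<in> variable_exponents \<and>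
       q0 \<in> variable_exponents \<and> q1 \<in> variable_exponents \<and>
       esssup lebesgue p0 < \<infinity> \<and> essinf lebesgue (\<lambda>x. p1 x / p0 x) > 1 \<longrightarrow>
       (\<exists>c::real. 0 < c \<and>
          (\<forall>f :: real^'n \<Rightarrow> complex.
             f \<in> borel_measurable lebesgue \<and> ess_support f \<subseteq> unit_cube \<longrightarrow>
             lorentz_norm p0 q0 f \<le> ennreal c * lorentz_norm p1 q1 f)))
    \<and>
    (\<forall>p0 p1 q :: real^'n \<Rightarrow> ennreal.
       p0 \<in> variable_exponents \<and> p1 \<in> variable_exponents \<and> q \<in> variable_exponents \<and>
       (\<forall>x. p0 x \<le> p1 x) \<longrightarrow>
       (\<exists>c::real. 0 < c \<and>
          (\<forall>f :: real^'n \<Rightarrow> complex.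
             f \<in> borel_measurable lebesgue \<and> ess_support f \<subseteq> unit_cube \<longrightarrow>
             lorentz_norm p0 q f \<le> ennreal c * lorentz_norm p1 q f)))"
proof -
  have cube: "cbox 0 1 \<in> sets (lebesgue :: (real^'n) measure)"
      "emeasure lebesgue (cbox 0 (1 :: real^'n)) < \<infinity>"
    using emeasure_lborel_cbox_finite[of 0 "1 :: real^'n"] by auto
  show ?thesis
  proof (intro conjI allI impI; (elim conjE)?)
    fix p q0 q1 :: "real^'n \<Rightarrow> ennreal"
    assume q0: "q0 \<in> variable_exponents" and le: "\<forall>x. q0 x \<le> q1 x"
    have bound: "lorentz_norm p q1 f \<le> ennreal 2 * lorentz_norm p q0 f" for f
      using lorentz_norm_mono_fine_exponent[OF q0] le by blast
    have "lorentz_norm p q1 f < \<infinity>" if "lorentz_norm p q0 f < \<infinity>" for f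
      by (rule le_less_trans[OF bound]) (use that in \<open>simp add: ennreal_mult_less_top\<close>)
    then have "lorentz_space p q0 \<subseteq> lorentz_space p q1"
      by (auto simp: lorentz_space_def)
    then show "continuously_embedded (lorentz_space p q0) (lorentz_norm p q0)
                               (lorentz_space p q1) (lorentz_norm p q1)"
      unfolding continuously_embedded_def using bound by (auto intro!: exI[of _ 2])
  next
    fix q :: "real^'n \<Rightarrow> ennreal"
    assume q: "q \<in> variable_exponents"
    obtain C where C: "0 < C" "\<And>f. f \<in> borel_measurable lebesgue \<Longrightarrow>
        Linf_norm f \<le> ennreal C * lorentz_norm (\<lambda>_. \<infinity>) q f"
      using Linf_norm_le_lorentz_norm[OF q] by blast
    obtain D where D: "0 < D" "\<And>f. f \<in> borel_measurable lebesgue \<Longrightarrow>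
        lorentz_norm (\<lambda>_. \<infinity>) q f \<le> ennreal D * Linf_norm f"
      using lorentz_norm_le_Linf_norm[OF q] by blast
    have lower: "ennreal (1 / D) * lorentz_norm (\<lambda>_. \<infinity>) q f \<le> Linf_norm f"
      if "f \<in> borel_measurable lebesgue" for f
    proof -
      have "ennreal (1 / D) * lorentz_norm (\<lambda>_. \<infinity>) q f
          \<le> ennreal (1 / D) * (ennreal D * Linf_norm f)"
        by (intro mult_left_mono D(2) that) simp
      also have "\<dots> = Linf_norm f"
        using D(1) by (simp add: mult.assoc[symmetric] ennreal_mult[symmetric])
      finally show ?thesis .
    qed
    have "Linf_norm f < \<infinity> \<longleftrightarrow> lorentz_norm (\<lambda>_. \<infinity>) q f < \<infinity>"
      if "f \<in> borel_measurable lebesgue" for f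
      using C(2)[OF that] D(2)[OF that]
      by (auto simp: ennreal_mult_less_top intro: order.strict_trans1)
    then have eq: "lorentz_space (\<lambda>_. \<infinity>) q = Linf_space"
      by (auto simp: lorentz_space_def Linf_space_def)
    have "\<forall>f\<in>Linf_space. ennreal (1 / D) * lorentz_norm (\<lambda>_. \<infinity>) q f \<le> Linf_norm f
        \<and> Linf_norm f \<le> ennreal C * lorentz_norm (\<lambda>_. \<infinity>) q f"
      using lower C(2) by (simp add: Linf_space_def)
    moreover have "0 < 1 / D" using D(1) by simp
    ultimately show "equal_with_equivalent_norms (lorentz_space (\<lambda>_. \<infinity>) q)
        (lorentz_norm (\<lambda>_. \<infinity>) q) Linf_space Linf_norm"
      unfolding equal_with_equivalent_norms_def eq using C(1) by blast
  next
    fix p0 p1 q0 q1 :: "real^'n \<Rightarrow> ennreal"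
    assume exps: "p0 \<in> variable_exponents" "p1 \<in> variable_exponents"
        "q0 \<in> variable_exponents" "q1 \<in> variable_exponents"
      and ratio: "essinf lebesgue (\<lambda>x. p1 x / p0 x) > 1"
    obtain \<alpha> where \<alpha>: "1 < \<alpha>" "AE x in lebesgue. ennreal \<alpha> \<le> p1 x / p0 x"
      using essinf_greater_real[of 1 lebesgue "\<lambda>x. p1 x / p0 x"] ratio by auto
    have mult: "AE x in lebesgue. ennreal \<alpha> * p0 x \<le> p1 x"
      using \<alpha>(2)
    proof eventually_elim
      fix x assume le: "ennreal \<alpha> \<le> p1 x / p0 x"
      \<comment> \<open>A quotient with infinite denominator is \<open>0\<close>, even for \<open>\<infinity> / \<infinity>\<close>, so the lower bound on the
        ratio excludes \<open>p0 x = \<infinity>\<close>.\<close>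
      have "0 < ennreal \<alpha>" using \<alpha>(1) by simp
      then have "p0 x \<noteq> top" using le by (auto simp: leD)
      moreover have "p0 x \<noteq> 0" using variable_exponentsD(2)[OF exps(1), of x] by simp
      ultimately have "p1 x / p0 x * p0 x = p1 x"
        by (simp add: ennreal_divide_times less_top)
      moreover have "ennreal \<alpha> * p0 x \<le> p1 x / p0 x * p0 x" by (intro mult_right_mono le) simp
      ultimately show "ennreal \<alpha> * p0 x \<le> p1 x" by simp
    qed
    obtain C where "0 < C" "\<And>f. f \<in> borel_measurable lebesgue \<Longrightarrow>
        AE x in lebesgue. x \<notin> cbox 0 (1 :: real^'n) \<longrightarrow> f x = 0 \<Longrightarrow>
        lorentz_norm p0 q0 f \<le> ennreal C * lorentz_norm p1 q1 f"
      using lorentz_norm_le_larger_exponent_finite_measure[OF exps \<alpha>(1) mult cube] by blast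
    then show "\<exists>c::real. 0 < c \<and>
            (\<forall>f :: real^'n \<Rightarrow> complex.
               f \<in> borel_measurable lebesgue \<and> ess_support f \<subseteq> unit_cube \<longrightarrow>
               lorentz_norm p0 q0 f \<le> ennreal c * lorentz_norm p1 q1 f)"
      using AE_zero_outside_cube by (intro exI[of _ C]) auto
  next
    fix p0 p1 q :: "real^'n \<Rightarrow> ennreal"
    assume exps: "p0 \<in> variable_exponents" "p1 \<in> variable_exponents" "q \<in> variable_exponents"
      and le: "\<forall>x. p0 x \<le> p1 x"
    obtain C where "0 < C" "\<And>f. f \<in> borel_measurable lebesgue \<Longrightarrow>
        AE x in lebesgue. x \<notin> cbox 0 (1 :: real^'n) \<longrightarrow> f x = 0 \<Longrightarrow>
        lorentz_norm p0 q f \<le> ennreal C * lorentz_norm p1 q f"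
      using lorentz_norm_mono_exponent_finite_measure[OF exps _ cube] le by blast
    then show "\<exists>c::real. 0 < c \<and>
            (\<forall>f :: real^'n \<Rightarrow> complex.
               f \<in> borel_measurable lebesgue \<and> ess_support f \<subseteq> unit_cube \<longrightarrow>
               lorentz_norm p0 q f \<le> ennreal c * lorentz_norm p1 q f)"
      using AE_zero_outside_cube by (intro exI[of _ C]) auto
  qed
qed

end
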